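(* Let $C$ be a binary linear code of length $n$ which is isodual, let $X:=\{1,\ldots,n\}$, and let $G=\mathrm{Aut}(C)$. Let $\sigma\in S_n$ be such that $C^\perp=C^\sigma$. Let $t$ be a positive integer; $G$ acts on the set $\binom{X}{t}$ of $t$-subsets of $X$, and assume that this action has exactly two orbits, \[ \binom{X}{t}=GT_1\sqcup GT_2, \] with $(GT_1)^\sigma=GT_2$. Then: (1) $J_{C,T}+J_{C^\perp,T}$ is independent of the choice of $T\subseteq X$ with $|T|=t$. (2) Let $f\in \mathrm{Harm}_t$ be a harmonic function of degree $t$ which is invariant under $\mathrm{Aut}(C)$, i.e. $f^\tau=f$ for all $\tau\in\mathrm{Aut}(C)$. Then \[ w_{C,f}+w_{C^\perp,f}=0. \]
   Context: A binary linear code of length $n$ is a subspace $C\subseteq\mathbb{F}_2^n$; its dual is $C^\perp=\{y\in\mathbb{F}_2^n : \sum_i x_iy_i=0 \ \forall x\in C\}$. For $\sigma\in S_n$, $C^\sigma:=\{(c_{\sigma(1)},\ldots,c_{\sigma(n)}) : (c_1,\ldots,c_n)\in C\}$, and $\mathrm{Aut}(C)=\{\sigma\in S_n: C^\sigma=C\}$. $C$ is isodual if $C$ and $C^\perp$ are equivalent (i.e. $C^\perp=C^\sigma$ for some $\sigma\in S_n$). $S_n$ acts on subsets of $X$ by $\{i_1,\ldots,i_k\}^\tau=\{\tau(i_1),\ldots,\tau(i_k)\}$; for a set $\mathcal{S}$ of subsets, $\mathcal{S}^\tau=\{S^\tau:S\in\mathcal{S}\}$. Jacobi polynomial: for $T\subseteq[n]$,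 $J_{C,T}(w,z,x,y)=\sum_{c\in C}w^{m_0(c)}z^{m_1(c)}x^{n_0(c)}y^{n_1(c)}$, where $m_i(c)=|\{j\in T: c_j=i\}|$ and $n_i(c)=|\{j\in[n]\setminus T: c_j=i\}|$. Harmonic functions: let $\mathbb{R}X_k$ be the real vector space with basis the $k$-subsets of $X$; elements $f=\sum_{z}f(z)z$ are identified with functions on $k$-subsets. For $f\in\mathbb{R}X_k$ define $\widetilde f(u)=\sum_{z\subseteq u,|z|=k}f(z)$ for all $u\subseteq X$. The differentiation $\gamma$ is the linear map with $\gamma(z)=\sum_{y\subset z,|y|=k-1}y$ for each $k$-subset $z$, and $\mathrm{Harm}_k=\ker(\gamma|_{\mathbb{R}X_k})$. The action of $S_n$ on $\mathrm{Harm}_k$ is by linear extension of the action on $k$-subsets. For $f\in\mathrm{Harm}_k$, the harmonic weight enumerator is $w_{C,f}(x,y)=\sum_{c\in C}\widetilde f(\mathrm{supp}(c))x^{n-\mathrm{wt}(c)}y^{\mathrm{wt}(c)}$, where $\mathrm{supp}(c)=\{i:c_i\neq0\}$ and $\mathrm{wt}(c)=|\mathrm{supp}(c)|$. *)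

theory Defs
  imports
    "HOL-Analysis.Analysis"
    "HOL-Combinatorics.Permutations"
    "HOL-Library.Z2"
    "HOL-Library.Poly_Mapping"
begin

text \<open>
  The coordinate set \<open>X = {1,\<dots>,n}\<close> is the universe of a finite type \<open>'n\<close>, so that
  \<open>n = CARD('n)\<close>, vectors over \<open>\<bbbF>\<^sub>2\<close> have type \<open>bit ^ 'n\<close>, and \<open>S\<^sub>n\<close> consists of the
  functions \<open>\<sigma>\<close> with \<open>\<sigma> permutes UNIV\<close>.  A binary linear code is a set \<open>C\<close> with
  \<open>vec.subspace C\<close>.
\<close>

definition dual_code :: "(bit ^ 'n) set \<Rightarrow> (bit ^ 'n) set" where
  "dual_code C = {y. \<forall>x\<in>C. (\<Sum>i\<in>UNIV. x $ i * y $ i) = 0}"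

definition perm_code :: "('n \<Rightarrow> 'n) \<Rightarrow> (bit ^ 'n) set \<Rightarrow> (bit ^ 'n) set" where
  "perm_code \<sigma> C = (\<lambda>c. \<chi> i. c $ \<sigma> i) ` C"

definition Aut :: "(bit ^ 'n) set \<Rightarrow> ('n \<Rightarrow> 'n) set" where
  "Aut C = {\<sigma>. \<sigma> permutes UNIV \<and> perm_code \<sigma> C = C}"

definition isodual :: "(bit ^ 'n) set \<Rightarrow> bool" where
  "isodual C \<longleftrightarrow> (\<exists>\<sigma>. \<sigma> permutes UNIV \<and> dual_code C = perm_code \<sigma> C)"

definition orbit_set :: "('n \<Rightarrow> 'n) set \<Rightarrow> 'n set \<Rightarrow> 'n set set" where
  "orbit_set G T = {\<tau> ` T | \<tau>. \<tau> \<in> G}"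

definition perm_family :: "('n \<Rightarrow> 'n) \<Rightarrow> 'n set set \<Rightarrow> 'n set set" where
  "perm_family \<sigma> \<S> = {\<sigma> ` S | S. S \<in> \<S>}"

text \<open>
  Multivariate polynomials with indeterminates indexed by \<open>'v\<close>: finitely supported maps from
  exponent vectors to coefficients, with the convolution product of \<^theory>\<open>HOL-Library.Poly_Mapping\<close>.
\<close>

type_synonym ('v, 'a) mvpoly = "('v \<Rightarrow>\<^sub>0 nat) \<Rightarrow>\<^sub>0 'a"

definition indet :: "'v \<Rightarrow> ('v, 'a::comm_ring_1) mvpoly" where
  "indet v = Poly_Mapping.single (Poly_Mapping.single v 1) 1"

definition const_poly :: "'a \<Rightarrow> ('v, 'a::comm_ring_1) mvpoly" where
  "const_poly a = Poly_Mapping.single 0 a"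

datatype jacobi_var = JW | JZ | JX | JY

definition jacobi_poly :: "(bit ^ 'n) set \<Rightarrow> 'n set \<Rightarrow> (jacobi_var, int) mvpoly" where
  "jacobi_poly C T =
     (\<Sum>c\<in>C. indet JW ^ card {j \<in> T. c $ j = 0} * indet JZ ^ card {j \<in> T. c $ j = 1}
           * indet JX ^ card {j \<in> - T. c $ j = 0} * indet JY ^ card {j \<in> - T. c $ j = 1})"

text \<open>
  Elements of \<open>\<real>X\<^sub>k\<close> are the formal real linear combinations \<open>f :: 'n set \<Rightarrow>\<^sub>0 real\<close> of sets whose
  keys all have cardinality \<open>k\<close>; \<open>diff_map\<close> and \<open>act_lin\<close> are linear extensions from basis elements.
\<close>

definition real_subsets :: "nat \<Rightarrow> ('n set \<Rightarrow>\<^sub>0 real) set" where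
  "real_subsets k = {f. \<forall>z\<in>Poly_Mapping.keys f. card z = k}"

definition diff_map :: "('n set \<Rightarrow>\<^sub>0 real) \<Rightarrow> ('n set \<Rightarrow>\<^sub>0 real)" where
  "diff_map f = (\<Sum>z\<in>Poly_Mapping.keys f.
      \<Sum>y | y \<subset> z \<and> card y + 1 = card z. Poly_Mapping.single y (Poly_Mapping.lookup f z))"

definition Harm :: "nat \<Rightarrow> ('n set \<Rightarrow>\<^sub>0 real) set" where
  "Harm k = {f \<in> real_subsets k. diff_map f = 0}"

definition act_lin :: "('n \<Rightarrow> 'n) \<Rightarrow> ('n set \<Rightarrow>\<^sub>0 real) \<Rightarrow> ('n set \<Rightarrow>\<^sub>0 real)" where
  "act_lin \<tau> f =
     (\<Sum>z\<in>Poly_Mapping.keys f. Poly_Mapping.single (\<tau> ` z) (Poly_Mapping.lookup f z))"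

definition tilde :: "nat \<Rightarrow> ('n set \<Rightarrow>\<^sub>0 real) \<Rightarrow> 'n set \<Rightarrow> real" where
  "tilde k f u = (\<Sum>z | z \<subseteq> u \<and> card z = k. Poly_Mapping.lookup f z)"

definition supp :: "bit ^ 'n \<Rightarrow> 'n set" where
  "supp c = {i. c $ i \<noteq> 0}"

definition wt :: "bit ^ 'n \<Rightarrow> nat" where
  "wt c = card (supp c)"

datatype weight_var = WX | WY

text \<open>The first argument is the degree of the harmonic function.\<close>

definition harmonic_weight_enum ::
  "nat \<Rightarrow> (bit ^ 'n) set \<Rightarrow> ('n set \<Rightarrow>\<^sub>0 real) \<Rightarrow> (weight_var, real) mvpoly" where
  "harmonic_weight_enum k C f =
     (\<Sum>c\<in>C. const_poly (tilde k f (supp c)) * indet WX ^ (CARD('n) - wt c) * indet WY ^ wt c)"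

end

theory Submission
  imports Defs
begin

text \<open>
  Transporting along \<open>c \<mapsto> c \<circ> \<tau>\<close> gives \<open>J\<^bsub>C\<^sup>\<tau>,T\<^esub> = J\<^bsub>C,\<tau>T\<^esub>\<close>; hence \<open>J\<^bsub>C,T\<^esub>\<close> is constant on the
  orbits of \<open>Aut C\<close>, and since \<open>\<sigma>\<close> interchanges the two orbits, \<open>J\<^bsub>C,T\<^esub> + J\<^bsub>C,\<sigma>T\<^esub>\<close> is always the sum
  of the two orbit values.  An invariant harmonic \<open>f\<close> is likewise constant on the two orbits,
  which have equal size; as \<open>\<gamma> f = 0\<close> forces the coefficients of \<open>f\<close> to sum to zero, the two values
  are opposite.  So \<open>f\<^sup>\<sigma> = -f\<close>, and the terms of \<open>c\<close> and \<open>c \<circ> \<sigma>\<close> in the two weight enumerators cancel.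
\<close>

lemma inj_on_permute_coords:
  assumes "\<tau> permutes UNIV"
  shows "inj_on (\<lambda>c :: 'a ^ 'n. \<chi> i. c $ \<tau> i) A"
proof (rule inj_onI)
  fix c d :: "'a ^ 'n"
  assume eq: "(\<chi> i. c $ \<tau> i) = (\<chi> i. d $ \<tau> i)"
  have "c $ \<tau> (inv \<tau> i) = d $ \<tau> (inv \<tau> i)" for i
    using arg_cong[OF eq, of "\<lambda>v. v $ inv \<tau> i"] by simp
  then show "c = d"
    by (simp add: permutes_inverses(1)[OF assms] vec_eq_iff)
qed

lemma sum_perm_code:
  assumes "\<tau> permutes UNIV"
  shows "sum h (perm_code \<tau> C) = (\<Sum>c\<in>C. h (\<chi> i. c $ \<tau> i))"
  unfolding perm_code_def
  by (subst sum.reindex[OF inj_on_permute_coords[OF assms]]) (simp add: o_def)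

lemma card_Collect_image:
  assumes "inj \<tau>"
  shows "card {j \<in> \<tau> ` T. P j} = card {j \<in> T. P (\<tau> j)}"
proof -
  have "{j \<in> \<tau> ` T. P j} = \<tau> ` {j \<in> T. P (\<tau> j)}" by auto
  then show ?thesis
    using card_image[OF inj_on_subset[OF assms subset_UNIV]] by metis
qed

text \<open>Entry j of the permuted word is entry \<open>\<tau> j\<close> of c, so counts over T
  become counts over its image under \<open>\<tau>\<close>; bijectivity transports the complement in
  the same way.\<close>

lemma jacobi_poly_perm_code:
  assumes "\<tau> permutes UNIV"
  shows "jacobi_poly (perm_code \<tau> C) T = jacobi_poly C (\<tau> ` T)"
proof -
  have "inj \<tau>" "- (\<tau> ` T) = \<tau> ` (- T)"
    using assms by (auto simp: permutes_inj bij_image_Compl_eq permutes_bij)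
  then show ?thesis
    by (simp add: jacobi_poly_def sum_perm_code[OF assms] card_Collect_image)
qed

lemma jacobi_poly_orbit:
  assumes "S \<in> orbit_set (Aut C) T"
  shows "jacobi_poly C S = jacobi_poly C T"
  using assms by (auto simp: orbit_set_def Aut_def jacobi_poly_perm_code[symmetric])

text \<open>By injectivity only the basis element z can land on the image of z. If z is not a key,
  both sides are 0.\<close>

lemma lookup_act_lin_image:
  fixes \<tau> :: "'n::finite \<Rightarrow> 'n"
  assumes "inj \<tau>"
  shows "Poly_Mapping.lookup (act_lin \<tau> f) (\<tau> ` z) = Poly_Mapping.lookup f z"
proof -
  have "Poly_Mapping.lookup (act_lin \<tau> f) (\<tau> ` z)
      = (\<Sum>y\<in>Poly_Mapping.keys f. if y = z then Poly_Mapping.lookup f y else 0)"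
    by (auto simp: act_lin_def lookup_sum lookup_single when_def inj_image_eq_iff[OF assms]
        intro!: sum.cong)
  also have "\<dots> = Poly_Mapping.lookup f z"
    by (simp add: in_keys_iff)
  finally show ?thesis .
qed

lemma lookup_orbit:
  fixes f :: "'n::finite set \<Rightarrow>\<^sub>0 real"
  assumes "\<forall>\<tau>\<in>Aut C. act_lin \<tau> f = f" and "S \<in> orbit_set (Aut C) T"
  shows "Poly_Mapping.lookup f S = Poly_Mapping.lookup f T"
proof -
  obtain \<tau> where \<tau>: "\<tau> \<in> Aut C" "S = \<tau> ` T"
    using assms(2) by (auto simp: orbit_set_def)
  then have "inj \<tau>" by (auto simp: Aut_def intro: permutes_inj)
  then show ?thesis
    using lookup_act_lin_image[of \<tau> f T] \<tau> assms(1) by simp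
qed

text \<open>Double counting: every t-set has exactly t subsets of size t - 1, so the differentiation
  multiplies the total of the coefficients by t.\<close>

lemma sum_lookup_diff_map:
  fixes f :: "'n::finite set \<Rightarrow>\<^sub>0 real"
  assumes "f \<in> real_subsets t" and "t > 0"
  shows "(\<Sum>y\<in>UNIV. Poly_Mapping.lookup (diff_map f) y)
       = real t * (\<Sum>z\<in>Poly_Mapping.keys f. Poly_Mapping.lookup f z)"
proof -
  have card_facets: "card {y. y \<subset> z \<and> card y + 1 = card z} = t"
    if "z \<in> Poly_Mapping.keys f" for z
  proof -
    have z: "card z = t" using that assms(1) by (auto simp: real_subsets_def)
    \<comment> \<open>For t = 0 the truncated \<open>t - 1\<close> would wrongly admit the empty set
      on the right; positivity of t also makes the inclusion strict.\<close>
    then have "{y. y \<subset> z \<and> card y + 1 = card z} = {y. y \<subseteq> z \<and> card y = t - 1}"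
      using \<open>t > 0\<close> by auto
    then show ?thesis
      using n_subsets[of z "t - 1"] z \<open>t > 0\<close> binomial_symmetric[of "t - 1" t] by simp
  qed
  have "(\<Sum>y\<in>UNIV. Poly_Mapping.lookup (diff_map f) y)
      = (\<Sum>y\<in>UNIV. \<Sum>z\<in>Poly_Mapping.keys f. \<Sum>x | x \<subset> z \<and> card x + 1 = card z.
          if x = y then Poly_Mapping.lookup f z else 0)"
    by (simp add: diff_map_def lookup_sum lookup_single when_def)
  \<comment> \<open>With y innermost, the indicator of x = y sums to a single term.\<close>
  also have "\<dots> = (\<Sum>z\<in>Poly_Mapping.keys f. \<Sum>x | x \<subset> z \<and> card x + 1 = card z. \<Sum>y\<in>UNIV.
          if x = y then Poly_Mapping.lookup f z else 0)"
    by (subst sum.swap) (intro sum.cong refl sum.swap)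
  also have "\<dots> = (\<Sum>z\<in>Poly_Mapping.keys f. real t * Poly_Mapping.lookup f z)"
    by (intro sum.cong refl) (simp add: card_facets[simplified])
  finally show ?thesis by (simp add: sum_distrib_left)
qed

lemma sum_lookup_Harm:
  fixes f :: "'n::finite set \<Rightarrow>\<^sub>0 real"
  assumes "f \<in> Harm t" and "t > 0"
  shows "(\<Sum>z | card z = t. Poly_Mapping.lookup f z) = 0"
proof -
  have f: "f \<in> real_subsets t" "diff_map f = 0"
    using assms(1) by (auto simp: Harm_def)
  have "(\<Sum>z | card z = t. Poly_Mapping.lookup f z)
      = (\<Sum>z\<in>Poly_Mapping.keys f. Poly_Mapping.lookup f z)"
    using f(1) by (intro sum.mono_neutral_right) (auto simp: real_subsets_def in_keys_iff)
  then show ?thesis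
    using sum_lookup_diff_map[OF f(1) assms(2)] f(2) assms(2) by simp
qed

lemma supp_permute_coords:
  assumes "\<tau> permutes UNIV"
  shows "\<tau> ` supp (\<chi> i. c $ \<tau> i) = supp c"
  using permutes_surj[OF assms] by (fastforce simp: supp_def image_iff surj_def)

lemma wt_permute_coords:
  assumes "\<tau> permutes UNIV"
  shows "wt (\<chi> i. c $ \<tau> i) = wt c"
  using card_image[OF inj_on_subset[OF permutes_inj[OF assms] subset_UNIV],
      of "supp (\<chi> i. c $ \<tau> i)"]
  by (simp add: wt_def supp_permute_coords[OF assms])

text \<open>Taking images under \<open>\<sigma>\<close> is a bijection from the t-subsets of u to
  those of its image, and each term changes sign.\<close>

lemma tilde_image:
  assumes "inj \<sigma>"
    and "\<And>z. card z = t \<Longrightarrow> Poly_Mapping.lookup f (\<sigma> ` z) = - Poly_Mapping.lookup f z"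
  shows "tilde t f (\<sigma> ` u) = - tilde t f u"
proof -
  have inj: "inj_on ((`) \<sigma>) A" for A
    by (simp add: inj_on_def inj_image_eq_iff[OF assms(1)])
  have card: "card (\<sigma> ` z) = card z" for z
    by (rule card_image) (rule inj_on_subset[OF assms(1) subset_UNIV])
  have "{z. z \<subseteq> \<sigma> ` u \<and> card z = t} = (`) \<sigma> ` {z. z \<subseteq> u \<and> card z = t}"
    by (auto simp: subset_image_iff card)
  then show ?thesis
    by (simp add: tilde_def sum.reindex[OF inj] assms(2) sum_negf)
qed

lemma harmonic_weight_enum_perm_code:
  assumes "\<sigma> permutes UNIV"
    and "\<And>z. card z = t \<Longrightarrow> Poly_Mapping.lookup f (\<sigma> ` z) = - Poly_Mapping.lookup f z"
  shows "harmonic_weight_enum t (perm_code \<sigma> C) f = - harmonic_weight_enum t C f"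
proof -
  have "tilde t f (supp (\<chi> i. c $ \<sigma> i)) = - tilde t f (supp c)" for c
    \<comment> \<open>The set u is the support of the permuted word, because its image under
      \<open>\<sigma>\<close> is the support of c.\<close>
    using tilde_image[where u = "supp (\<chi> i. c $ \<sigma> i)", OF permutes_inj[OF assms(1)] assms(2)]
    by (simp add: supp_permute_coords[OF assms(1)])
  moreover have "const_poly (- a) = (- const_poly a :: (weight_var, real) mvpoly)" for a :: real
    by (simp add: const_poly_def single_uminus)
  ultimately show ?thesis
    by (simp add: harmonic_weight_enum_def sum_perm_code[OF assms(1)] wt_permute_coords[OF assms(1)]
        sum_negf)
qed

theorem theorem1p1:
  fixes C :: "(bit ^ 'n::finite) set"
    and \<sigma> :: "'n \<Rightarrow> 'n"
    and t :: nat
    and T\<^sub>1 T\<^sub>2 :: "'n set"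
  assumes "vec.subspace C"
    and "isodual C"
    and "\<sigma> permutes UNIV"
    and "dual_code C = perm_code \<sigma> C"
    and "t > 0"
    and "{T :: 'n set. card T = t} = orbit_set (Aut C) T\<^sub>1 \<union> orbit_set (Aut C) T\<^sub>2"
    and "orbit_set (Aut C) T\<^sub>1 \<inter> orbit_set (Aut C) T\<^sub>2 = {}"
    and "perm_family \<sigma> (orbit_set (Aut C) T\<^sub>1) = orbit_set (Aut C) T\<^sub>2"
  shows "(\<forall>T T' :: 'n set. card T = t \<longrightarrow> card T' = t \<longrightarrow>
            jacobi_poly C T + jacobi_poly (dual_code C) T =
            jacobi_poly C T' + jacobi_poly (dual_code C) T')
       \<and> (\<forall>f \<in> Harm t. (\<forall>\<tau> \<in> Aut C. act_lin \<tau> f = f) \<longrightarrow>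
            harmonic_weight_enum t C f + harmonic_weight_enum t (dual_code C) f = 0)"
proof -
  let ?O1 = "orbit_set (Aut C) T\<^sub>1" and ?O2 = "orbit_set (Aut C) T\<^sub>2"
  note perm = assms(3) and dual = assms(4) and orbits = assms(6)
  have orbit_iff: "T \<in> ?O1 \<or> T \<in> ?O2 \<longleftrightarrow> card T = t" for T
    unfolding Un_iff[symmetric] orbits[symmetric] by simp
  have inj: "inj \<sigma>" using perm by (rule permutes_inj)
  have inj_image: "inj_on ((`) \<sigma>) A" for A
    by (simp add: inj_on_def inj_image_eq_iff[OF inj])
  have card_im: "card (\<sigma> ` T) = card T" for T
    by (rule card_image) (rule inj_on_subset[OF inj subset_UNIV])
  have O2: "?O2 = (`) \<sigma> ` ?O1"
    using assms(8) by (simp add: perm_family_def Setcompr_eq_image)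
  have \<sigma>12: "\<sigma> ` T \<in> ?O2" if "T \<in> ?O1" for T
    using that O2 by blast
  \<comment> \<open>The hypothesis sends only the first orbit to the second. A member of the second
    orbit whose image stayed there would share that image with a member of the first, against
    injectivity and disjointness.\<close>
  have \<sigma>21: "\<sigma> ` T \<in> ?O1" if "T \<in> ?O2" for T
  proof (rule ccontr)
    assume "\<sigma> ` T \<notin> ?O1"
    then have "\<sigma> ` T \<in> ?O2"
      using that orbit_iff[of T] orbit_iff[of "\<sigma> ` T"] card_im[of T] by simp
    then obtain S where "S \<in> ?O1" "\<sigma> ` S = \<sigma> ` T"
      unfolding O2 by auto
    then have "T \<in> ?O1" by (simp add: inj_image_eq_iff[OF inj])
    then show False using that assms(7) by blast
  qed

  have "jacobi_poly C T + jacobi_poly (dual_code C) T = jacobi_poly C T\<^sub>1 + jacobi_poly C T\<^sub>2"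
    if "card T = t" for T
  proof -
    have "T \<in> ?O1 \<or> T \<in> ?O2" using that orbit_iff by simp
    then show ?thesis
    proof
      assume "T \<in> ?O1"
      then show ?thesis
        using jacobi_poly_orbit[OF \<sigma>12, of T] jacobi_poly_orbit[of T C T\<^sub>1]
        by (simp add: dual jacobi_poly_perm_code[OF perm])
    next
      assume "T \<in> ?O2"
      then show ?thesis
        using jacobi_poly_orbit[OF \<sigma>21, of T] jacobi_poly_orbit[of T C T\<^sub>2]
        by (simp add: dual jacobi_poly_perm_code[OF perm])
    qed
  qed
  moreover have "harmonic_weight_enum t C f + harmonic_weight_enum t (dual_code C) f = 0"
    if f: "f \<in> Harm t" and inv: "\<forall>\<tau>\<in>Aut C. act_lin \<tau> f = f" for f
  proof -
    let ?f = "Poly_Mapping.lookup f"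
    \<comment> \<open>The identity puts \<open>T\<^sub>1\<close> in its own orbit, so the orbit size
      is nonzero and can be cancelled below.\<close>
    have "id \<in> Aut C"
      by (simp add: Aut_def perm_code_def permutes_id)
    then have nonempty: "?O1 \<noteq> {}" by (auto simp: orbit_set_def)
    have "0 = (\<Sum>z\<in>?O1 \<union> ?O2. ?f z)"
      using sum_lookup_Harm[OF f assms(5)] unfolding orbits by simp
    also have "\<dots> = (\<Sum>z\<in>?O1. ?f z) + (\<Sum>z\<in>?O2. ?f z)"
      using assms(7) by (simp add: sum.union_disjoint)
    also have "\<dots> = card ?O1 * ?f T\<^sub>1 + card ?O2 * ?f T\<^sub>2"
      using lookup_orbit[OF inv, where T = T\<^sub>1] lookup_orbit[OF inv, where T = T\<^sub>2] by simp
    also have "card ?O2 = card ?O1"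
      unfolding O2 by (rule card_image[OF inj_image])
    finally have "real (card ?O1) * (?f T\<^sub>1 + ?f T\<^sub>2) = 0"
      by (simp add: distrib_left)
    then have opp: "?f T\<^sub>1 = - ?f T\<^sub>2" using nonempty by (simp add: eq_neg_iff_add_eq_0)
    \<comment> \<open>Since \<open>\<sigma>\<close> swaps the orbits, it swaps the two opposite
      values of f.\<close>
    have "?f (\<sigma> ` z) = - ?f z" if "card z = t" for z
    proof -
      have "z \<in> ?O1 \<or> z \<in> ?O2" using that orbit_iff by simp
      then show ?thesis
      proof
        assume z: "z \<in> ?O1"
        show ?thesis
          unfolding lookup_orbit[OF inv \<sigma>12[OF z]] lookup_orbit[OF inv z] opp by simp
      next
        assume z: "z \<in> ?O2"
        show ?thesis
          unfolding lookup_orbit[OF inv \<sigma>21[OF z]] lookup_orbit[OF inv z] by (rule opp)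
      qed
    qed
    then show ?thesis
      by (simp add: dual harmonic_weight_enum_perm_code[OF perm])
  qed
  ultimately show ?thesis by simp
qed

end
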